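(* For a productable collection $\{\mathfrak G_s\}_{s\in S}$ of absolutely homogeneous GECs and an arbitrary total order $\preceq$ on $S$, the product GEC ${}^{\preceq}\!\prod^{*}_{s\in S}\mathfrak G_s$ is absolutely homogeneous as well.
   Context: A GEC (full graph with edge-coloring) is a pair $\mathfrak{G}=(V,\kappa)$ where $V$ is a set of vertices and $\kappa\colon V\times V\to Y$ is a surjection onto some set $Y$ such that for all $x,y,z\in V$: $\kappa(x,y)=\kappa(z,z)\iff x=y$; and $\kappa(y,x)=\kappa(x,y)$. The palette is $\mathrm{Col}(\mathfrak G)=\{\kappa(x,y): x\neq y\}$; the common value $\kappa(z,z)$ is the pseudocolor. A partial morphism from $(V,\kappa)$ into $(W,\lambda)$ is a function $f\colon A\to W$ with $A\subset V$ and $\kappa(a,b)=\lambda(f(a),f(b))$ for all $a,b\in A$; it is an isomorphism if $A=V$ and $f$ is bijective; an automorphism is a self-isomorphism. A GEC is absolutely homogeneous if every partial morphism from it into itself extends to an automorphism. A collection $\{\mathfrak G_s=(V_s,\kappa_s)\}_{s\in S}$ of GECs is productable if $S\neq\varnothing$, all $\mathfrak G_s$ are non-empty, all their pseudocolors coincide, and their palettes are pairwise disjoint. For $\mathfrak u=(u_s)_{s\in S}$, $\mathfrak v=(v_s)_{s\in S}$ in $\prod_{s\in S}V_s$ put $\mathrm{Diff}(\mathfrak u,\mathfrak v)=\{s\in S: u_s\neq v_s\}$. Given a total order $\preceq$ on $S$ and $\mathfrak a\in\prod_{s\in S}V_s$, the product ${}^{\preceq}\!\prod^{\mathfrak a}_{s\in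 S}\mathfrak G_s$ is the GEC $(W,\lambda)$ where $W$ is the set of all $\mathfrak x\in\prod_{s\in S}V_s$ such that $\mathrm{Diff}(\mathfrak x,\mathfrak a)$ is well-ordered by $\preceq$, and, for $\mathfrak x=(x_s)_{s\in S},\mathfrak y=(y_s)_{s\in S}\in W$, $\lambda(\mathfrak x,\mathfrak y)$ is the common pseudocolor if $\mathfrak x=\mathfrak y$, and $\lambda(\mathfrak x,\mathfrak y)=\kappa_\ell(x_\ell,y_\ell)$ if $\mathfrak x\neq\mathfrak y$, where $\ell$ is the $\preceq$-least element of $\mathrm{Diff}(\mathfrak x,\mathfrak y)$ (which is well-ordered). If all $\mathfrak G_s$ are absolutely homogeneous, then the isomorphism type of this product does not depend on $\mathfrak a$, and it is denoted by ${}^{\preceq}\!\prod^{*}_{s\in S}\mathfrak G_s$. *)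

theory Defs
  imports "HOL-Library.FuncSet" "HOL-Library.Disjoint_Sets"
begin

text \<open>
  A GEC is a vertex set together with an edge-coloring that is a surjection onto some set.
  The target set is then the image of the coloring on pairs of vertices, so it is not a
  separate component. Values of the coloring outside the vertex set are irrelevant.
\<close>

record ('v, 'c) gec_struct =
  verts :: "'v set"
  col :: "'v \<Rightarrow> 'v \<Rightarrow> 'c"

definition gec :: "('v, 'c) gec_struct \<Rightarrow> bool" where
  "gec G \<longleftrightarrow>
     (\<forall>x\<in>verts G. \<forall>y\<in>verts G. \<forall>z\<in>verts G. col G x y = col G z z \<longleftrightarrow> x = y) \<and>
     (\<forall>x\<in>verts G. \<forall>y\<in>verts G. col G y x = col G x y)"

definition palette :: "('v, 'c) gec_struct \<Rightarrow> 'c set" where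
  "palette G = {col G x y | x y. x \<in> verts G \<and> y \<in> verts G \<and> x \<noteq> y}"

text \<open>Meaningful for non-empty GECs only.\<close>

definition pseudocolor :: "('v, 'c) gec_struct \<Rightarrow> 'c" where
  "pseudocolor G = (THE c. \<exists>z\<in>verts G. c = col G z z)"

text \<open>
  A partial function with domain \<open>A\<close> is a total function of which only the values on \<open>A\<close>
  matter; in particular, automorphisms are unconstrained outside the vertex set.
\<close>

definition partial_morphism ::
  "('v, 'c) gec_struct \<Rightarrow> ('w, 'c) gec_struct \<Rightarrow> 'v set \<Rightarrow> ('v \<Rightarrow> 'w) \<Rightarrow> bool" where
  "partial_morphism G H A f \<longleftrightarrow>
     A \<subseteq> verts G \<and> f \<in> A \<rightarrow> verts H \<and>
     (\<forall>a\<in>A. \<forall>b\<in>A. col G a b = col H (f a) (f b))"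

definition gec_isomorphism ::
  "('v, 'c) gec_struct \<Rightarrow> ('w, 'c) gec_struct \<Rightarrow> ('v \<Rightarrow> 'w) \<Rightarrow> bool" where
  "gec_isomorphism G H f \<longleftrightarrow>
     partial_morphism G H (verts G) f \<and> bij_betw f (verts G) (verts H)"

definition gec_automorphism :: "('v, 'c) gec_struct \<Rightarrow> ('v \<Rightarrow> 'v) \<Rightarrow> bool" where
  "gec_automorphism G f \<longleftrightarrow> gec_isomorphism G G f"

definition absolutely_homogeneous :: "('v, 'c) gec_struct \<Rightarrow> bool" where
  "absolutely_homogeneous G \<longleftrightarrow>
     gec G \<and>
     (\<forall>A f. partial_morphism G G A f \<longrightarrow>
        (\<exists>g. gec_automorphism G g \<and> (\<forall>a\<in>A. g a = f a)))"

definition productable :: "'s set \<Rightarrow> ('s \<Rightarrow> ('v, 'c) gec_struct) \<Rightarrow> bool" where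
  "productable S G \<longleftrightarrow>
     S \<noteq> {} \<and>
     (\<forall>s\<in>S. gec (G s) \<and> verts (G s) \<noteq> {}) \<and>
     (\<forall>s\<in>S. \<forall>t\<in>S. pseudocolor (G s) = pseudocolor (G t)) \<and>
     disjoint_family_on (\<lambda>s. palette (G s)) S"

definition Diff :: "'s set \<Rightarrow> ('s \<Rightarrow> 'v) \<Rightarrow> ('s \<Rightarrow> 'v) \<Rightarrow> 's set" where
  "Diff S u v = {s\<in>S. u s \<noteq> v s}"

definition least_in :: "'s rel \<Rightarrow> 's set \<Rightarrow> 's" where
  "least_in r D = (THE l. l \<in> D \<and> (\<forall>s\<in>D. (l, s) \<in> r))"

definition common_pseudocolor :: "'s set \<Rightarrow> ('s \<Rightarrow> ('v, 'c) gec_struct) \<Rightarrow> 'c" where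
  "common_pseudocolor S G = (THE c. \<forall>s\<in>S. pseudocolor (G s) = c)"

text \<open>
  Points of the full product are extensional functions on \<open>S\<close>, so that equality of points is
  equality of all their coordinates in \<open>S\<close>. The relation \<open>r\<close> is the (reflexive) total order on
  \<open>S\<close>, with \<open>(s, t) \<in> r\<close> meaning that \<open>s\<close> precedes or equals \<open>t\<close>.
\<close>

definition gec_product ::
  "'s set \<Rightarrow> 's rel \<Rightarrow> ('s \<Rightarrow> ('v, 'c) gec_struct) \<Rightarrow> ('s \<Rightarrow> 'v) \<Rightarrow> ('s \<Rightarrow> 'v, 'c) gec_struct"
where
  "gec_product S r G a =
     \<lparr>verts = {x \<in> (\<Pi>\<^sub>E s\<in>S. verts (G s)).
                 well_order_on (Diff S x a) (Restr r (Diff S x a))},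
      col = (\<lambda>x y. if x = y then common_pseudocolor S G
                   else let l = least_in r (Diff S x y) in col (G l) (x l) (y l))\<rparr>"

end

theory Submission
  imports Defs
begin

text \<open>
  Write \<open>W\<close> for the vertex set of the product. Call two points of \<open>W\<close> indistinguishable below
  \<open>s\<close> if their coordinates strictly before \<open>s\<close> coincide; they split at \<open>s\<close> if in addition their
  coordinates at \<open>s\<close> differ. Distinct points of \<open>W\<close> split at exactly one coordinate, and because
  the palettes are disjoint, the color of a pair of points determines where the pair splits
  (\<open>splits_transfer\<close>). A partial morphism \<open>f\<close> of the product, with domain \<open>A\<close>, therefore
  preserves both relations.

  Consequently, for each \<open>s\<close> and each class of points that are indistinguishable below \<open>s\<close>, the
  assignment \<open>b s \<mapsto> f b s\<close>, for \<open>b\<close> in \<open>A\<close> and in the class, is a well-defined partial morphism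
  of the factor at \<open>s\<close>. Absolute homogeneity of the factor extends it to an automorphism of the
  factor; for a class that misses \<open>A\<close> the identity is taken. Letting these automorphisms act, each
  on its own class, gives a map \<open>F\<close> on points that extends \<open>f\<close>. It keeps the splitting coordinate
  of every pair and the color there, hence all colors.

  Two things remain, and both are delicate because the order on the coordinates need not be
  well-founded, so that no recursion along it is available. The first is that \<open>F\<close> maps \<open>W\<close> into
  itself. Where \<open>F x\<close> differs from \<open>x\<close>, it coincides on all earlier coordinates with the point
  \<open>f b\<close> of \<open>W\<close> for some \<open>b\<close> in \<open>A\<close>, and this keeps the set of coordinates at which \<open>F x\<close> leaves
  the base point well-ordered (\<open>patched_point_in_verts\<close>). The second is that \<open>F\<close> is onto. A
  preimage \<open>x\<close> of \<open>y\<close> is written down directly: \<open>s\<close> is decoded with the inverse of the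
  automorphism belonging to \<open>b\<close> if \<open>y\<close> agrees below \<open>s\<close> with \<open>f b\<close>, and \<open>x\<close> copies \<open>y\<close> if there is
  no such \<open>b\<close>. At a copied coordinate \<open>F\<close> must act as the identity, and the reason is once more
  that two points of \<open>W\<close> which differ do so at a least coordinate.
\<close>

section \<open>Splitting coordinates\<close>

lemma well_order_on_Restr_iff:
  assumes "linear_order_on S r" and "D \<subseteq> S"
  shows "well_order_on D (Restr r D) \<longleftrightarrow>
    (\<forall>E\<subseteq>D. E \<noteq> {} \<longrightarrow> (\<exists>m\<in>E. \<forall>s\<in>E. (m, s) \<in> r))"
proof -
  have lin: "linear_order_on D (Restr r D)"
    using assms unfolding order_on_defs
    by (auto simp: refl_on_def total_on_def antisym_def subset_iff intro: trans_Restr)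
  have "Field (Restr r D) = D"
    using lin by (auto simp: Field_def order_on_defs refl_on_def)
  then have "well_order_on D (Restr r D) \<longleftrightarrow>
      (\<forall>E\<subseteq>D. E \<noteq> {} \<longrightarrow> (\<exists>m\<in>E. \<forall>s\<in>E. (m, s) \<in> Restr r D))"
    using Linear_order_Well_order_iff[of "Restr r D"] lin by simp
  also have "\<dots> \<longleftrightarrow> (\<forall>E\<subseteq>D. E \<noteq> {} \<longrightarrow> (\<exists>m\<in>E. \<forall>s\<in>E. (m, s) \<in> r))"
    by (meson IntE IntI SigmaI subsetD)
  finally show ?thesis .
qed

locale ordered_gec_family =
  fixes S :: "'s set" and r :: "'s rel"
    and G :: "'s \<Rightarrow> ('v, 'c) gec_struct" and a :: "'s \<Rightarrow> 'v"
  assumes productable: "productable S G"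
    and linear_order: "linear_order_on S r"
begin

abbreviation product :: "('s \<Rightarrow> 'v, 'c) gec_struct" where
  "product \<equiv> gec_product S r G a"

definition agree_below :: "'s \<Rightarrow> ('s \<Rightarrow> 'v) \<Rightarrow> ('s \<Rightarrow> 'v) \<Rightarrow> bool" where
  "agree_below s x y \<longleftrightarrow> (\<forall>t\<in>S. (t, s) \<in> r \<longrightarrow> t \<noteq> s \<longrightarrow> x t = y t)"

definition splits :: "'s \<Rightarrow> ('s \<Rightarrow> 'v) \<Rightarrow> ('s \<Rightarrow> 'v) \<Rightarrow> bool" where
  "splits s x y \<longleftrightarrow> s \<in> S \<and> agree_below s x y \<and> x s \<noteq> y s"

lemma prec_trans: "(s, t) \<in> r \<Longrightarrow> (t, u) \<in> r \<Longrightarrow> (s, u) \<in> r"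
  and prec_antisym: "(s, t) \<in> r \<Longrightarrow> (t, s) \<in> r \<Longrightarrow> s = t"
  and prec_refl: "s \<in> S \<Longrightarrow> (s, s) \<in> r"
  and prec_total: "s \<in> S \<Longrightarrow> t \<in> S \<Longrightarrow> (s, t) \<in> r \<or> (t, s) \<in> r"
  using linear_order unfolding order_on_defs
  unfolding trans_def antisym_def refl_on_def total_on_def by metis+

lemma agree_below_refl: "agree_below s x x"
  and agree_below_sym: "agree_below s x y \<Longrightarrow> agree_below s y x"
  and agree_below_trans: "agree_below s x y \<Longrightarrow> agree_below s y z \<Longrightarrow> agree_below s x z"
  unfolding agree_below_def by auto

lemma agree_below_mono: "agree_below s x y \<Longrightarrow> (t, s) \<in> r \<Longrightarrow> agree_below t x y"
  unfolding agree_below_def using prec_trans prec_antisym by blast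

lemma gec_factor: "s \<in> S \<Longrightarrow> gec (G s)"
  using productable unfolding productable_def by blast

lemma verts_product_iff:
  "x \<in> verts product \<longleftrightarrow> x \<in> (\<Pi>\<^sub>E s\<in>S. verts (G s)) \<and>
     (\<forall>E\<subseteq>Diff S x a. E \<noteq> {} \<longrightarrow> (\<exists>m\<in>E. \<forall>s\<in>E. (m, s) \<in> r))"
  using well_order_on_Restr_iff[OF linear_order, of "Diff S x a"]
  by (simp add: gec_product_def Diff_def)

lemma verts_product_coord: "x \<in> verts product \<Longrightarrow> s \<in> S \<Longrightarrow> x s \<in> verts (G s)"
  by (auto simp: verts_product_iff)

text \<open>
  The coordinates at which two points differ lie in the union of the two well-ordered sets of
  coordinates at which they leave the base point.
\<close>

lemma ex_splits:
  assumes "x \<in> verts product" "y \<in> verts product" "x \<noteq> y"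
  shows "\<exists>l. splits l x y"
proof -
  have least: "\<exists>m\<in>E. \<forall>s\<in>E. (m, s) \<in> r"
    if "z \<in> verts product" "E \<subseteq> Diff S z a" "E \<noteq> {}" for z E
    using that unfolding verts_product_iff by blast
  define D where "D = Diff S x y"
  have ext: "x \<in> (\<Pi>\<^sub>E s\<in>S. verts (G s))" "y \<in> (\<Pi>\<^sub>E s\<in>S. verts (G s))"
    using assms by (auto simp only: verts_product_iff)
  have "D \<noteq> {}"
    using PiE_ext[OF ext] assms(3) by (auto simp: D_def Diff_def)
  define D1 where "D1 = D \<inter> Diff S x a"
  define D2 where "D2 = D \<inter> Diff S y a"
  have D: "D = D1 \<union> D2" and DS: "D1 \<subseteq> S" "D2 \<subseteq> S"
    by (auto simp: D_def D1_def D2_def Diff_def)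
  have 1: "\<exists>m\<in>D1. \<forall>s\<in>D1. (m, s) \<in> r" if "D1 \<noteq> {}"
    using least[OF assms(1)] that by (simp add: D1_def)
  have 2: "\<exists>m\<in>D2. \<forall>s\<in>D2. (m, s) \<in> r" if "D2 \<noteq> {}"
    using least[OF assms(2)] that by (simp add: D2_def)
  have "\<exists>m\<in>D. \<forall>s\<in>D. (m, s) \<in> r"
  proof (cases "D1 = {} \<or> D2 = {}")
    case True
    then have "D = D1 \<or> D = D2" using D by blast
    then show ?thesis using 1 2 \<open>D \<noteq> {}\<close> by (elim disjE) simp_all
  next
    case False
    obtain m1 where m1: "m1 \<in> D1" "\<forall>s\<in>D1. (m1, s) \<in> r" using 1 False by blast
    obtain m2 where m2: "m2 \<in> D2" "\<forall>s\<in>D2. (m2, s) \<in> r" using 2 False by blast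
    have "(m1, m2) \<in> r \<or> (m2, m1) \<in> r" using m1(1) m2(1) DS prec_total by blast
    then show ?thesis using m1 m2 D prec_trans by (metis Un_iff)
  qed
  then obtain m where m: "m \<in> D" "\<forall>s\<in>D. (m, s) \<in> r" by blast
  then have "splits m x y"
    unfolding splits_def agree_below_def D_def Diff_def using prec_antisym by blast
  then show ?thesis ..
qed

lemma least_in_Diff_eq:
  assumes "splits l x y"
  shows "least_in r (Diff S x y) = l"
proof -
  have l: "l \<in> Diff S x y" "\<forall>s\<in>Diff S x y. (l, s) \<in> r"
    using assms prec_total prec_refl unfolding splits_def agree_below_def Diff_def by blast+
  show ?thesis
    unfolding least_in_def by (rule the_equality) (use l prec_antisym in blast)+
qed

lemma col_product_splits:
  assumes "splits l x y"
  shows "col product x y = col (G l) (x l) (y l)"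
proof -
  have "x \<noteq> y" using assms by (auto simp: splits_def)
  then show ?thesis
    using least_in_Diff_eq[OF assms] by (simp add: gec_product_def Let_def)
qed

lemma col_product_diag:
  assumes "s \<in> S" "v \<in> verts (G s)"
  shows "col product x x = col (G s) v v"
proof -
  have "pseudocolor (G s) = col (G s) v v"
    unfolding pseudocolor_def
    using gec_factor[OF assms(1)] assms(2) unfolding gec_def by (intro the_equality) blast+
  moreover have "common_pseudocolor S G = pseudocolor (G s)"
    unfolding common_pseudocolor_def
    using productable assms(1) unfolding productable_def by (intro the_equality) metis+
  ultimately show ?thesis by (simp add: gec_product_def)
qed

lemma agree_below_iff_not_splits:
  assumes "x \<in> verts product" "y \<in> verts product" "s \<in> S"
  shows "agree_below s x y \<longleftrightarrow> (\<forall>l. splits l x y \<longrightarrow> (s, l) \<in> r)"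
proof
  assume *: "agree_below s x y"
  show "\<forall>l. splits l x y \<longrightarrow> (s, l) \<in> r"
    using * assms(3) prec_total prec_refl unfolding splits_def agree_below_def by metis
next
  assume *: "\<forall>l. splits l x y \<longrightarrow> (s, l) \<in> r"
  show "agree_below s x y"
  proof (cases "x = y")
    case False
    then obtain l where "splits l x y" using ex_splits assms by blast
    then show ?thesis using * agree_below_mono unfolding splits_def by blast
  qed (simp add: agree_below_refl)
qed

lemma gec_product: "gec product"
proof -
  have sym: "splits l y x" if "splits l x y" for l x y
    using that agree_below_sym by (auto simp: splits_def)
  have ne: "col product x y \<noteq> col product z z"
    if xy: "x \<in> verts product" "y \<in> verts product" "x \<noteq> y" for x y z
  proof -
    obtain l where l: "splits l x y" using ex_splits xy by blast
    then have lS: "l \<in> S" and "x l \<noteq> y l" by (auto simp: splits_def)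
    then have "col (G l) (x l) (y l) \<noteq> col (G l) (x l) (x l)"
      using gec_factor[OF lS] verts_product_coord[OF _ lS] xy unfolding gec_def by metis
    then show ?thesis
      using col_product_splits[OF l] col_product_diag[OF lS verts_product_coord[OF xy(1) lS]]
      by simp
  qed
  have diag: "col product x x = col product z z" for x z
    by (simp add: gec_product_def)
  have comm: "col product y x = col product x y"
    if xy: "x \<in> verts product" "y \<in> verts product" for x y
  proof (cases "x = y")
    case False
    then obtain l where l: "splits l x y" using ex_splits xy by blast
    then have lS: "l \<in> S" by (auto simp: splits_def)
    then have "col (G l) (y l) (x l) = col (G l) (x l) (y l)"
      using gec_factor[OF lS] verts_product_coord[OF _ lS] xy unfolding gec_def by metis
    then show ?thesis
      using col_product_splits[OF l] col_product_splits[OF sym[OF l]] by simp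
  qed simp
  show ?thesis unfolding gec_def using ne diag comm by blast
qed

text \<open>
  The color of a pair that splits at \<open>l\<close> lies in the palette of the factor at \<open>l\<close>. The pseudocolor
  lies in no palette, and no color lies in two.
\<close>

lemma splits_transfer:
  assumes "x \<in> verts product" "y \<in> verts product" "x' \<in> verts product" "y' \<in> verts product"
    and col: "col product x y = col product x' y'" and l: "splits l x y"
  shows "splits l x' y'"
proof -
  have palette: "col product u v \<in> palette (G m)"
    if "u \<in> verts product" "v \<in> verts product" "splits m u v" for u v m
    using that verts_product_coord col_product_splits[of m u v]
    unfolding palette_def splits_def by blast
  have "x \<noteq> y" using l by (auto simp: splits_def)
  then have "x' \<noteq> y'"
    using gec_product col assms(1-4) unfolding gec_def by metis
  then obtain m where m: "splits m x' y'" using ex_splits assms by blast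
  have "col product x y \<in> palette (G l) \<inter> palette (G m)"
    using palette[OF assms(1,2) l] palette[OF assms(3,4) m] col by simp
  then have "l = m"
    using productable l m unfolding productable_def disjoint_family_on_def splits_def by blast
  with m show ?thesis by simp
qed

lemma agree_below_transfer:
  assumes "x \<in> verts product" "y \<in> verts product" "x' \<in> verts product" "y' \<in> verts product"
    and "col product x y = col product x' y'" and "s \<in> S"
  shows "agree_below s x y \<longleftrightarrow> agree_below s x' y'"
  using assms splits_transfer[of x y x' y'] splits_transfer[of x' y' x y]
  by (auto simp: agree_below_iff_not_splits)

text \<open>
  A nonempty set of coordinates at which \<open>x\<close> leaves the base point either avoids the coordinates at
  which \<open>x\<close> differs from \<open>y\<close>, and then has a least element because \<open>y\<close> is a vertex; or it contains
  such a coordinate \<open>s\<close>, and then on its part strictly before \<open>s\<close> the point \<open>x\<close> coincides with a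
  vertex \<open>b\<close>, so that this part is empty or has a least element.
\<close>

lemma patched_point_in_verts:
  assumes x: "x \<in> (\<Pi>\<^sub>E s\<in>S. verts (G s))" and y: "y \<in> verts product"
    and patch: "\<And>s. s \<in> S \<Longrightarrow> x s \<noteq> y s \<Longrightarrow> \<exists>b\<in>verts product. agree_below s x b"
  shows "x \<in> verts product"
proof -
  have "\<exists>m\<in>E. \<forall>s\<in>E. (m, s) \<in> r" if E: "E \<subseteq> Diff S x a" "E \<noteq> {}" for E
  proof (cases "\<exists>s\<in>E. x s \<noteq> y s")
    case False
    then have "E \<subseteq> Diff S y a" using E(1) by (auto simp: Diff_def)
    then show ?thesis using y E(2) unfolding verts_product_iff by blast
  next
    case True
    then obtain s where s: "s \<in> E" "x s \<noteq> y s" by blast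
    have ES: "E \<subseteq> S" using E(1) by (auto simp: Diff_def)
    obtain b where b: "b \<in> verts product" "agree_below s x b"
      using patch s ES by blast
    define E' where "E' = {t\<in>E. (t, s) \<in> r \<and> t \<noteq> s}"
    show ?thesis
    proof (cases "E' = {}")
      case True
      then have "\<forall>t\<in>E. (s, t) \<in> r"
        using s(1) ES prec_total prec_refl unfolding E'_def by blast
      then show ?thesis using s(1) by blast
    next
      case False
      have "E' \<subseteq> Diff S b a"
        using E(1) b(2) unfolding E'_def Diff_def agree_below_def by auto
      then obtain m where m: "m \<in> E'" "\<forall>t\<in>E'. (m, t) \<in> r"
        using b(1) False unfolding verts_product_iff by blast
      have "(m, t) \<in> r" if "t \<in> E" for t
      proof (cases "t \<in> E'")
        case False
        then have "(s, t) \<in> r" using that s(1) ES prec_total prec_refl unfolding E'_def by blast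
        then show ?thesis using m(1) prec_trans unfolding E'_def by blast
      qed (use m in blast)
      then show ?thesis using m(1) unfolding E'_def by blast
    qed
  qed
  then show ?thesis using x unfolding verts_product_iff by blast
qed

section \<open>Extending a partial morphism\<close>

text \<open>
  Let \<open>b\<close> and \<open>c\<close> in \<open>A\<close> agree with \<open>x\<close>, hence with each other, below \<open>s\<close>. If they differ at \<open>s\<close>,
  they split there; then \<open>f b\<close> and \<open>f c\<close> also split at \<open>s\<close>, and the common color of the two pairs is
  read off at \<open>s\<close>. If they coincide at \<open>s\<close>, then so do \<open>f b\<close> and \<open>f c\<close>, which agree below \<open>s\<close> but
  cannot split there. So \<open>b s \<mapsto> f b s\<close> is well defined on the whole class and preserves the colors of
  the factor.
\<close>

lemma ex_local_automorphism:
  assumes hom: "absolutely_homogeneous (G s)" and s: "s \<in> S"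
    and f: "partial_morphism product product A f"
  shows "\<exists>g. gec_automorphism (G s) g \<and> (\<forall>b\<in>A. agree_below s b x \<longrightarrow> g (b s) = f b s)"
proof -
  define B where "B = {b\<in>A. agree_below s b x}"
  have vA: "b \<in> verts product" "f b \<in> verts product" if "b \<in> A" for b
    using f that unfolding partial_morphism_def by blast+
  have col_f: "col product b c = col product (f b) (f c)" if "b \<in> A" "c \<in> A" for b c
    using f that unfolding partial_morphism_def by blast
  have key: "col (G s) (b s) (c s) = col (G s) (f b s) (f c s) \<and> (b s = c s \<longrightarrow> f b s = f c s)"
    if "b \<in> B" "c \<in> B" for b c
  proof -
    have bc: "b \<in> A" "c \<in> A" "agree_below s b c"
      using that agree_below_sym agree_below_trans unfolding B_def by blast+
    have agree: "agree_below s (f b) (f c)"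
      using agree_below_transfer[of b c "f b" "f c" s] bc vA col_f s by blast
    have split_iff: "splits s b c \<longleftrightarrow> splits s (f b) (f c)"
      using splits_transfer[of b c "f b" "f c" s] splits_transfer[of "f b" "f c" b c s]
        bc vA col_f by metis
    show ?thesis
    proof (cases "b s = c s")
      case True
      then have "f b s = f c s" using split_iff agree s by (auto simp: splits_def)
      moreover have "col (G s) (b s) (b s) = col (G s) (f b s) (f b s)"
        using col_product_diag[of s _ b] s vA bc(1) verts_product_coord by metis
      ultimately show ?thesis using True by simp
    next
      case False
      then have "splits s b c" using bc s by (simp add: splits_def)
      then show ?thesis
        using False split_iff col_product_splits[of s b c] col_product_splits[of s "f b" "f c"]
          col_f bc by simp
    qed
  qed
  define h where "h v = f (SOME b. b \<in> B \<and> b s = v) s" for v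
  have h: "h (b s) = f b s" if "b \<in> B" for b
  proof -
    have "(SOME c. c \<in> B \<and> c s = b s) \<in> B \<and> (SOME c. c \<in> B \<and> c s = b s) s = b s"
      by (rule someI[of _ b]) (use that in blast)
    then show ?thesis using key that unfolding h_def by blast
  qed
  have "partial_morphism (G s) (G s) ((\<lambda>b. b s) ` B) h"
    unfolding partial_morphism_def
  proof (intro conjI ballI)
    show "(\<lambda>b. b s) ` B \<subseteq> verts (G s)"
      using vA verts_product_coord[OF _ s] by (auto simp: B_def)
    show "h \<in> (\<lambda>b. b s) ` B \<rightarrow> verts (G s)"
      using h vA verts_product_coord[OF _ s] by (auto simp: B_def)
    fix u v assume "u \<in> (\<lambda>b. b s) ` B" "v \<in> (\<lambda>b. b s) ` B"
    then obtain b c where "b \<in> B" "c \<in> B" "u = b s" "v = c s" by blast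
    then show "col (G s) u v = col (G s) (h u) (h v)" using h key by metis
  qed
  then obtain g where "gec_automorphism (G s) g" "\<forall>v\<in>(\<lambda>b. b s) ` B. g v = h v"
    using hom unfolding absolutely_homogeneous_def by blast
  then show ?thesis using h by (auto simp: B_def intro!: exI[of _ g])
qed

text \<open>
  Dependence on the class below \<open>s\<close> alone is what will make the glued map keep splitting
  coordinates. The identity on classes that miss \<open>A\<close> is not an arbitrary default: automorphisms
  that move the coordinates of the base point could make the image of a vertex leave it on a set
  that is not well-ordered.
\<close>

lemma ex_local_automorphisms:
  assumes "\<And>s. s \<in> S \<Longrightarrow> absolutely_homogeneous (G s)"
    and "partial_morphism product product A f"
  shows "\<exists>\<phi>. (\<forall>s\<in>S. \<forall>x. gec_automorphism (G s) (\<phi> s x)) \<and>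
    (\<forall>s\<in>S. \<forall>x. \<forall>b\<in>A. agree_below s b x \<longrightarrow> \<phi> s x (b s) = f b s) \<and>
    (\<forall>s x y. agree_below s x y \<longrightarrow> \<phi> s x = \<phi> s y) \<and>
    (\<forall>s x. \<not> (\<exists>b\<in>A. agree_below s b x) \<longrightarrow> \<phi> s x = id)"
proof -
  define \<phi> where "\<phi> s x = (if \<exists>b\<in>A. agree_below s b x
      then SOME g. gec_automorphism (G s) g \<and> (\<forall>b\<in>A. agree_below s b x \<longrightarrow> g (b s) = f b s)
      else id)" for s x
  have sel: "gec_automorphism (G s) (\<phi> s x) \<and>
      (\<forall>b\<in>A. agree_below s b x \<longrightarrow> \<phi> s x (b s) = f b s)" if "s \<in> S" for s x
  proof (cases "\<exists>b\<in>A. agree_below s b x")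
    case True
    then show ?thesis
      using someI_ex[OF ex_local_automorphism[OF assms(1)[OF that] that assms(2), of x]]
      by (simp add: \<phi>_def)
  next
    case False
    then show ?thesis
      by (auto simp: \<phi>_def gec_automorphism_def gec_isomorphism_def partial_morphism_def)
  qed
  have cong: "\<phi> s x = \<phi> s y" if "agree_below s x y" for s x y
  proof -
    have "agree_below s b x \<longleftrightarrow> agree_below s b y" for b
      using that agree_below_sym agree_below_trans by blast
    then show ?thesis unfolding \<phi>_def by simp
  qed
  have off_A: "\<phi> s x = id" if "\<not> (\<exists>b\<in>A. agree_below s b x)" for s x
    using that by (simp add: \<phi>_def)
  show ?thesis by (rule exI[of _ \<phi>]) (use sel cong off_A in blast)
qed

lemma partial_morphism_extends:
  assumes hom: "\<And>s. s \<in> S \<Longrightarrow> absolutely_homogeneous (G s)"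
    and f: "partial_morphism product product A f"
  shows "\<exists>g. gec_automorphism product g \<and> (\<forall>b\<in>A. g b = f b)"
proof -
  obtain \<phi> where \<phi>: "\<forall>s\<in>S. \<forall>x. gec_automorphism (G s) (\<phi> s x)"
    "\<forall>s\<in>S. \<forall>x. \<forall>b\<in>A. agree_below s b x \<longrightarrow> \<phi> s x (b s) = f b s"
    "\<forall>s x y. agree_below s x y \<longrightarrow> \<phi> s x = \<phi> s y"
    "\<forall>s x. \<not> (\<exists>b\<in>A. agree_below s b x) \<longrightarrow> \<phi> s x = id"
    using ex_local_automorphisms[OF assms] by blast
  have aut: "gec_automorphism (G s) (\<phi> s x)" if "s \<in> S" for s x
    using \<phi>(1) that by blast
  have on_A: "\<phi> s x (b s) = f b s" if "s \<in> S" "b \<in> A" "agree_below s b x" for s x b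
    using \<phi>(2) that by blast
  have cong: "\<phi> s x = \<phi> s y" if "agree_below s x y" for s x y
    using \<phi>(3) that by blast
  have off_A: "\<phi> s x = id" if "\<not> (\<exists>b\<in>A. agree_below s b x)" for s x
    using \<phi>(4) that by blast
  have vA: "b \<in> verts product" "f b \<in> verts product" if "b \<in> A" for b
    using f that unfolding partial_morphism_def by blast+
  have col_f: "col product b c = col product (f b) (f c)" if "b \<in> A" "c \<in> A" for b c
    using f that unfolding partial_morphism_def by blast
  have bij: "bij_betw (\<phi> s x) (verts (G s)) (verts (G s))" if "s \<in> S" for s x
    using aut that unfolding gec_automorphism_def gec_isomorphism_def by blast
  have col_\<phi>: "col (G s) u v = col (G s) (\<phi> s x u) (\<phi> s x v)"
    if "s \<in> S" "u \<in> verts (G s)" "v \<in> verts (G s)" for s x u v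
    using aut that unfolding gec_automorphism_def gec_isomorphism_def partial_morphism_def by blast
  have ext: "x = y" if "x \<in> verts product" "y \<in> verts product" "\<And>s. s \<in> S \<Longrightarrow> x s = y s" for x y
    using that PiE_ext[of x S "\<lambda>s. verts (G s)" y]
    unfolding verts_product_iff by blast

  define F where "F x = (\<lambda>s\<in>S. \<phi> s x (x s))" for x
  have F_PiE: "F x \<in> (\<Pi>\<^sub>E s\<in>S. verts (G s))" if "x \<in> verts product" for x
    using that verts_product_coord bij_betwE[OF bij] by (auto simp: F_def)
  have F_agree: "agree_below s (F x) (F y)" if "agree_below s x y" for s x y
    unfolding agree_below_def[of s "F x"]
  proof (intro ballI impI)
    fix t assume t: "t \<in> S" "(t, s) \<in> r" "t \<noteq> s"
    then have "x t = y t" using that unfolding agree_below_def by blast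
    then show "F x t = F y t"
      using t(1) cong[OF agree_below_mono[OF that t(2)]] by (simp add: F_def)
  qed
  have F_f_coord: "F b s = f b s" if "b \<in> A" "s \<in> S" for b s
    using that on_A agree_below_refl by (simp add: F_def)
  have F_follows_f: "agree_below s (F x) (f b)" if "b \<in> A" "agree_below s b x" for s b x
    using F_agree[OF that(2)] F_f_coord[OF that(1)] unfolding agree_below_def by auto

  have F_verts: "F x \<in> verts product" if x: "x \<in> verts product" for x
  proof (rule patched_point_in_verts[OF F_PiE[OF x] x])
    fix s assume s: "s \<in> S" "F x s \<noteq> x s"
    then have "\<phi> s x \<noteq> id" by (auto simp: F_def)
    then obtain b where "b \<in> A" "agree_below s b x" using off_A by blast
    then show "\<exists>c\<in>verts product. agree_below s (F x) c"
      using F_follows_f vA by blast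
  qed
  have F_f: "F b = f b" if "b \<in> A" for b
    using ext F_verts vA F_f_coord that by blast

  have F_col: "col product x y = col product (F x) (F y)"
    if xy: "x \<in> verts product" "y \<in> verts product" for x y
  proof (cases "x = y")
    case True
    then show ?thesis by (simp add: gec_product_def)
  next
    case False
    then obtain l where l: "splits l x y" using ex_splits xy by blast
    then have lS: "l \<in> S" and agree: "agree_below l x y" and ne: "x l \<noteq> y l"
      by (auto simp: splits_def)
    have v: "x l \<in> verts (G l)" "y l \<in> verts (G l)" using verts_product_coord xy lS by blast+
    have Fl: "F x l = \<phi> l x (x l)" "F y l = \<phi> l x (y l)"
      using lS cong[OF agree] by (auto simp: F_def)
    have "F x l \<noteq> F y l"
      using ne v Fl bij[OF lS] unfolding bij_betw_def inj_on_def by metis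
    then have "splits l (F x) (F y)" using lS F_agree[OF agree] by (simp add: splits_def)
    then show ?thesis
      using col_product_splits l Fl col_\<phi>[OF lS v] by simp
  qed

  have F_inj: "inj_on F (verts product)"
  proof (rule inj_onI)
    fix x y assume *: "x \<in> verts product" "y \<in> verts product" "F x = F y"
    then have "col product x y = col product (F x) (F x)" using F_col by simp
    also have "\<dots> = col product x x" by (simp add: gec_product_def)
    finally show "x = y" using gec_product * unfolding gec_def by blast
  qed

  have F_surj: "\<exists>x\<in>verts product. F x = y" if y: "y \<in> verts product" for y
  proof -
    define J where "J s \<longleftrightarrow> (\<exists>b\<in>A. agree_below s (f b) y)" for s
    define w where "w s = (SOME b. b \<in> A \<and> agree_below s (f b) y)" for s
    have w: "w s \<in> A" "agree_below s (f (w s)) y" if "J s" for s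
      using someI_ex[of "\<lambda>b. b \<in> A \<and> agree_below s (f b) y"] that unfolding J_def w_def by blast+
    define x where "x = (\<lambda>s\<in>S. if J s then inv_into (verts (G s)) (\<phi> s (w s)) (y s) else y s)"
    have ys: "y s \<in> verts (G s)" if "s \<in> S" for s using verts_product_coord y that .
    have x_in: "x s \<in> verts (G s)" if "s \<in> S" for s
      using ys[OF that] bij_betwE[OF bij_betw_inv_into[OF bij]] that by (auto simp: x_def)
    have \<phi>_x: "\<phi> s (w s) (x s) = y s" if "s \<in> S" "J s" for s
      using bij_betw_inv_into_right[OF bij ys] that by (simp add: x_def)
    \<comment> \<open>The witness chosen at \<open>s\<close> need not be the one chosen at an earlier coordinate \<open>t\<close>, but both
      have images that agree with \<open>y\<close> below \<open>t\<close>, so they agree with each other there.\<close>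
    have x_follows: "agree_below s x b"
      if s: "s \<in> S" and b: "b \<in> A" "agree_below s (f b) y" for s b
      unfolding agree_below_def
    proof (intro ballI impI)
      fix t assume t: "t \<in> S" "(t, s) \<in> r" "t \<noteq> s"
      have fb: "agree_below t (f b) y" using agree_below_mono[OF b(2) t(2)] .
      then have J: "J t" using b(1) by (auto simp: J_def)
      have "agree_below t (f b) (f (w t))"
        using fb w(2)[OF J] agree_below_sym agree_below_trans by blast
      then have "agree_below t b (w t)"
        using agree_below_transfer[of b "w t" "f b" "f (w t)" t] b(1) w(1)[OF J] vA col_f t(1)
        by blast
      then have "\<phi> t (w t) (b t) = f b t" using on_A t(1) b(1) by blast
      also have "\<dots> = y t" using b(2) t unfolding agree_below_def by blast
      finally have "\<phi> t (w t) (b t) = \<phi> t (w t) (x t)" using \<phi>_x[OF t(1) J] by simp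
      then show "x t = b t"
        using bij[OF t(1)] x_in[OF t(1)] verts_product_coord[OF vA(1)[OF b(1)] t(1)]
        unfolding bij_betw_def inj_on_def by metis
    qed
    have x: "x \<in> verts product"
    proof (rule patched_point_in_verts[OF _ y])
      show "x \<in> (\<Pi>\<^sub>E s\<in>S. verts (G s))" using x_in by (auto simp: x_def)
      fix s assume s: "s \<in> S" "x s \<noteq> y s"
      then have "J s" by (auto simp: x_def split: if_splits)
      then show "\<exists>b\<in>verts product. agree_below s x b"
        using x_follows[OF s(1)] w vA by blast
    qed
    have F_J: "F x s = y s" if "s \<in> S" "J s" for s
      using \<phi>_x[OF that] cong[OF x_follows[OF that(1) w[OF that(2)]]] that(1) by (simp add: F_def)
    have F_not_J: "F x s = y s" if s: "s \<in> S" "\<not> J s" for s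
    proof -
      have "\<not> agree_below s b x" if b: "b \<in> A" for b
      proof
        assume agree: "agree_below s b x"
        have "f b \<noteq> y" using s(2) b agree_below_refl by (auto simp: J_def)
        then obtain m where m: "splits m (f b) y" using ex_splits[OF vA(2)[OF b] y] by blast
        then have mS: "m \<in> S" and Jm: "J m" and ne: "f b m \<noteq> y m"
          using b by (auto simp: J_def splits_def)
        \<comment> \<open>\<open>J\<close> is closed downwards and contains \<open>m\<close> but not \<open>s\<close>, so \<open>m\<close> comes before \<open>s\<close>.
          There \<open>F x\<close> equals both \<open>f b\<close> and \<open>y\<close>.\<close>
        have "(m, s) \<in> r" "m \<noteq> s"
          using prec_total[OF mS s(1)] Jm s(2) agree_below_mono unfolding J_def by blast+
        then have "F x m = f b m"
          using F_follows_f[OF b agree] mS unfolding agree_below_def by blast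
        then show False using F_J[OF mS Jm] ne by simp
      qed
      then have "\<phi> s x = id" using off_A by blast
      then show ?thesis using s by (simp add: F_def x_def)
    qed
    have "F x = y" using ext[OF F_verts[OF x] y] F_J F_not_J by blast
    then show ?thesis using x by blast
  qed

  have "bij_betw F (verts product) (verts product)"
    unfolding bij_betw_def using F_inj F_verts F_surj by blast
  then have "gec_automorphism product F"
    unfolding gec_automorphism_def gec_isomorphism_def partial_morphism_def
    using F_verts F_col by blast
  then show ?thesis using F_f by blast
qed

end

theorem theorem4p5:
  fixes S :: "'s set" and r :: "'s rel"
    and G :: "'s \<Rightarrow> ('v, 'c) gec_struct" and a :: "'s \<Rightarrow> 'v"
  assumes "productable S G"
    and "\<And>s. s \<in> S \<Longrightarrow> absolutely_homogeneous (G s)"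
    and "linear_order_on S r"
    and "a \<in> (\<Pi>\<^sub>E s\<in>S. verts (G s))"
  shows "absolutely_homogeneous (gec_product S r G a)"
proof -
  interpret ordered_gec_family S r G a
    using assms(1,3) by unfold_locales
  show ?thesis
    unfolding absolutely_homogeneous_def
    using gec_product partial_morphism_extends[OF assms(2)] by blast
qed

end
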